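(* Let $(\alpha_n^+,\beta_n^+,\lambda_n^+;\alpha_n^-,\beta_n^-,\lambda_n^-)_{n\in\mathbb{N}}$ be a sequence in $((0,\infty)\times[0,1)\times(0,\infty))^2$ and let $(\alpha^+,\beta^+,\lambda^+;\alpha^-,\beta^-,\lambda^-)\in((0,\infty)\times[0,1)\times(0,\infty))^2$. Then the following statements hold (all limits are for $n\to\infty$, and $\overset{w}{\to}$ denotes weak convergence of probability measures): (1) If $(\alpha_n^+,\beta_n^+,\lambda_n^+;\alpha_n^-,\beta_n^-,\lambda_n^-)\to(\alpha^+,\beta^+,\lambda^+;\alpha^-,\beta^-,\lambda^-)$, then $$\mathrm{TS}(\alpha_n^+,\beta_n^+,\lambda_n^+;\alpha_n^-,\beta_n^-,\lambda_n^-)\overset{w}{\to}\mathrm{TS}(\alpha^+,\beta^+,\lambda^+;\alpha^-,\beta^-,\lambda^-).$$ (2) If $\alpha_n^-\to0$ and $(\alpha_n^+,\beta_n^+,\lambda_n^+;\beta_n^-,\lambda_n^-)\to(\alpha^+,\beta^+,\lambda^+;\beta^-,\lambda^-)$, then $$\mathrm{TS}(\alpha_n^+,\beta_n^+,\lambda_n^+;\alpha_n^-,\beta_n^-,\lambda_n^-)\overset{w}{\to}\mathrm{TS}(\alpha^+,\beta^+,\lambda^+).$$ (3) If $\alpha_n^+,\alpha_n^-\to0$ and $(\beta_n^+,\lambda_n^+;\beta_n^-,\lambda_n^-)\to(\beta^+,\lambda^+;\beta^-,\lambda^-)$, then $$\mathrm{TS}(\alpha_n^+,\beta_n^+,\lambda_n^+;\alpha_n^-,\beta_n^-,\lambda_n^-)\overset{w}{\to}\delta_0.$$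 (4) If $\alpha_n^+,\alpha_n^-,\lambda_n^+,\lambda_n^-\to\infty$ and there are $\mu^+,\mu^-\ge0$ such that $$\Gamma(1-\beta^+)\frac{\alpha_n^+}{(\lambda_n^+)^{1-\beta^+}}\to\mu^+\quad\text{and}\quad\Gamma(1-\beta^-)\frac{\alpha_n^-}{(\lambda_n^-)^{1-\beta^-}}\to\mu^-,$$ then $$\mathrm{TS}(\alpha_n^+,\beta^+,\lambda_n^+;\alpha_n^-,\beta^-,\lambda_n^-)\overset{w}{\to}\delta_\mu,\qquad\text{where }\mu=\mu^+-\mu^-.$$ (5) If $\alpha_n^+,\alpha_n^-,\lambda_n^+,\lambda_n^-\to\infty$ and there are $\mu\in\mathbb{R}$ and $(\sigma^+)^2,(\sigma^-)^2>0$ such that $$\Gamma(1-\beta^+)\frac{\alpha_n^+}{(\lambda_n^+)^{1-\beta^+}}-\Gamma(1-\beta^-)\frac{\alpha_n^-}{(\lambda_n^-)^{1-\beta^-}}\to\mu,$$ $$\Gamma(2-\beta^+)\frac{\alpha_n^+}{(\lambda_n^+)^{2-\beta^+}}\to(\sigma^+)^2\quad\text{and}\quad\Gamma(2-\beta^-)\frac{\alpha_n^-}{(\lambda_n^-)^{2-\beta^-}}\to(\sigma^-)^2,$$ then $$\mathrm{TS}(\alpha_n^+,\beta^+,\lambda_n^+;\alpha_n^-,\beta^-,\lambda_n^-)\overset{w}{\to}N(\mu,\sigma^2),\qquad\text{where }\sigma^2=(\sigma^+)^2+(\sigma^-)^2.$$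
   Context: For $\alpha,\lambda\in(0,\infty)$ and $\beta\in[0,1)$, the one-sided tempered stable distribution $\mathrm{TS}(\alpha,\beta,\lambda)$ is the infinitely divisible distribution on $\mathbb{R}$ with characteristic function $\varphi(z)=\exp\big(\int_{\mathbb{R}}(e^{izx}-1)F(dx)\big)$, $z\in\mathbb{R}$, where $F(dx)=\frac{\alpha}{x^{1+\beta}}e^{-\lambda x}\mathbf{1}_{(0,\infty)}(x)\,dx$. For $\alpha^+,\lambda^+,\alpha^-,\lambda^-\in(0,\infty)$ and $\beta^+,\beta^-\in[0,1)$, the tempered stable distribution $\mathrm{TS}(\alpha^+,\beta^+,\lambda^+;\alpha^-,\beta^-,\lambda^-)$ is the law of $X^+-X^-$ with $X^+\sim\mathrm{TS}(\alpha^+,\beta^+,\lambda^+)$ and $X^-\sim\mathrm{TS}(\alpha^-,\beta^-,\lambda^-)$ independent; equivalently, its characteristic function is $\exp\big(\int_{\mathbb{R}}(e^{izx}-1)F(dx)\big)$ with $$F(dx)=\Big(\frac{\alpha^+}{x^{1+\beta^+}}e^{-\lambda^+x}\mathbf{1}_{(0,\infty)}(x)+\frac{\alpha^-}{|x|^{1+\beta^-}}e^{-\lambda^-|x|}\mathbf{1}_{(-\infty,0)}(x)\Big)dx.$$ $\delta_x$ is the Dirac measure at $x$, $N(\mu,\sigma^2)$ the normal distribution with mean $\mu$ and variance $\sigma^2$, and $\Gamma$ the Gamma function. *)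

theory Defs
  imports "HOL-Probability.Probability"
begin

definition infinitely_divisible :: "real measure \<Rightarrow> bool" where
  "infinitely_divisible M \<longleftrightarrow>
     (\<forall>n::nat. n \<ge> 1 \<longrightarrow> (\<exists>N. real_distribution N \<and>
        M = distr (Pi\<^sub>M {..<n} (\<lambda>_. N)) borel (\<lambda>x. \<Sum>i<n. x i)))"

text \<open>The argument \<open>l\<close> is the tempering parameter, usually written lambda.\<close>

definition ts_levy_measure :: "real \<Rightarrow> real \<Rightarrow> real \<Rightarrow> real measure" where
  "ts_levy_measure \<alpha> \<beta> l =
     density lborel (\<lambda>x. ennreal (\<alpha> / x powr (1 + \<beta>) * exp (- l * x) * indicator {0<..} x))"

text \<open>
  By Levy's uniqueness theorem at most one distribution has the prescribed characteristic
  function; for \<open>\<alpha>, l > 0\<close> and \<open>0 \<le> \<beta> < 1\<close> it exists, since the measure above then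
  integrates \<open>x\<close>.
\<close>

definition one_sided_TS :: "real \<Rightarrow> real \<Rightarrow> real \<Rightarrow> real measure" where
  "one_sided_TS \<alpha> \<beta> l =
     (THE M. real_distribution M \<and> infinitely_divisible M \<and>
        (\<forall>z. char M z = exp (CLINT x|ts_levy_measure \<alpha> \<beta> l. (iexp (z * x) - 1))))"

definition TS :: "real \<Rightarrow> real \<Rightarrow> real \<Rightarrow> real \<Rightarrow> real \<Rightarrow> real \<Rightarrow> real measure" where
  "TS \<alpha>p \<beta>p lp \<alpha>m \<beta>m lm =
     distr (one_sided_TS \<alpha>p \<beta>p lp \<Otimes>\<^sub>M one_sided_TS \<alpha>m \<beta>m lm) borel (\<lambda>(x, y). x - y)"

definition ts_parameters :: "(real \<times> real \<times> real) set" where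
  "ts_parameters = {0<..} \<times> {0..<1} \<times> {0<..}"

end

theory Submission
  imports Defs
begin

text \<open>
  The exponent of a one-sided tempered stable law is
  \<open>\<psi>(z) = \<integral> (e^(izx) - 1) \<alpha> x^(-1-\<beta>) e^(-\<lambda>x) dx\<close> over \<open>x > 0\<close>, and by Levy's continuity theorem it suffices
  to find the limit of \<open>\<psi>\<^sup>+(z) + \<psi>\<^sup>-(-z)\<close>. For converging parameters this is dominated
  convergence, since \<open>|e^(izx) - 1| \<le> |z| x\<close> and \<open>\<beta> < 1\<close>. For \<open>\<lambda> \<rightarrow> \<infinity>\<close> one expands \<open>e^(izx)\<close>: the
  moments \<open>\<Gamma>(k-\<beta>) \<alpha> / \<lambda>^(k-\<beta>)\<close> of the Levy measure satisfy \<open>m\<^sub>k\<^sub>+\<^sub>1 = (k-\<beta>) m\<^sub>k / \<lambda>\<close>, so only those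
  up to order one (respectively two) survive. That the laws exist at all is shown by
  approximating them with sums of independent variables whose laws are the normalised
  truncated Levy measure; the first absolute moments of these sums stay bounded, so they are tight.
\<close>

subsection \<open>Sums of independent variables and tightness\<close>

text \<open>The sum has the form that \<open>infinitely_divisible\<close> asks for, and it also
  builds the approximating laws of the existence proof. The coordinates of the product space are
  independent with law \<open>N\<close>, so characteristic functions multiply. The case
  \<open>n = 0\<close> gives the point mass at 0.\<close>

lemma
  fixes n :: nat
  assumes "real_distribution N"
  defines "S \<equiv> distr (Pi\<^sub>M {..<n} (\<lambda>_. N)) borel (\<lambda>x. \<Sum>i<n. x i)"
  shows real_distribution_iid_sum: "real_distribution S"
    and char_iid_sum: "char S t = char N t ^ n"
proof -
  interpret N: real_distribution N by fact
  interpret P: prob_space "Pi\<^sub>M {..<n} (\<lambda>_. N)"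
    by (intro prob_space_PiM N.prob_space_axioms)
  have comp [measurable]: "(\<lambda>x. x i) \<in> borel_measurable (Pi\<^sub>M {..<n} (\<lambda>_. N))" if "i < n" for i
    using measurable_component_singleton[of i "{..<n}" "\<lambda>_. N"] that by simp
  show "real_distribution S"
    unfolding S_def by (intro P.real_distribution_distr borel_measurable_sum) auto
  have eq: "distr (Pi\<^sub>M {..<n} (\<lambda>_. N)) borel (\<lambda>x. x i) = N" if "i < n" for i
  proof -
    have "distr (Pi\<^sub>M {..<n} (\<lambda>_. N)) borel (\<lambda>x. x i) = distr (Pi\<^sub>M {..<n} (\<lambda>_. N)) N (\<lambda>x. x i)"
      by (intro distr_cong) auto
    also have "\<dots> = N"
      using that by (intro distr_PiM_component N.prob_space_axioms) auto
    finally show ?thesis .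
  qed
  have indep: "P.indep_vars (\<lambda>_. borel) (\<lambda>i x. x i) {..<n}"
  proof (cases "n = 0")
    case False
    \<comment> \<open>\<open>N\<close> and \<open>borel\<close> have the same measurable sets, and
      restriction to \<open>{..<n}\<close> is the identity on the product space; hence the joint law
      of the coordinates is the product of their laws. The independence criterion used here asks for
      a nonempty index set.\<close>
    have "distr (Pi\<^sub>M {..<n} (\<lambda>_. N)) (Pi\<^sub>M {..<n} (\<lambda>_. borel)) (\<lambda>x. \<lambda>i\<in>{..<n}. x i)
      = distr (Pi\<^sub>M {..<n} (\<lambda>_. N)) (Pi\<^sub>M {..<n} (\<lambda>_. N)) (\<lambda>x. x)"
      by (intro distr_cong sets_PiM_cong) (auto simp: space_PiM restrict_PiE)
    then show ?thesis
      using False by (subst P.indep_vars_iff_distr_eq_PiM')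
        (auto simp: eq distr_id intro!: PiM_cong)
  qed (unfold P.indep_vars_def P.indep_sets_def, auto)
  show "char S t = char N t ^ n"
    unfolding S_def by (subst P.char_distr_sum[OF indep]) (simp add: eq)
qed

text \<open>The triangle inequality and the common law of the coordinates give a first absolute
  moment growing at most linearly in \<open>n\<close>. This feeds the tightness argument for the
  approximating sums.\<close>

lemma
  fixes n :: nat
  assumes "real_distribution N" and int: "integrable N (\<lambda>x. x)"
  defines "S \<equiv> distr (Pi\<^sub>M {..<n} (\<lambda>_. N)) borel (\<lambda>x. \<Sum>i<n. x i)"
  shows integrable_iid_sum: "integrable S (\<lambda>x. x)"
    and expectation_abs_iid_sum_le: "(LINT x|S. \<bar>x\<bar>) \<le> n * (LINT x|N. \<bar>x\<bar>)"
proof -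
  interpret N: real_distribution N by fact
  let ?P = "Pi\<^sub>M {..<n} (\<lambda>_. N)"
  have comp [measurable]: "(\<lambda>x. x i) \<in> borel_measurable ?P" if "i < n" for i
    using measurable_component_singleton[of i "{..<n}" "\<lambda>_. N"] that by simp
  have eq: "distr ?P N (\<lambda>x. x i) = N" if "i < n" for i
    using that by (intro distr_PiM_component N.prob_space_axioms) auto
  have m: "(\<lambda>x. x i) \<in> measurable ?P N" if "i < n" for i
    using that by auto
  have int_i: "integrable ?P (\<lambda>x. x i)" if "i < n" for i
    using integrable_distr[OF m[OF that], of "\<lambda>x. x"] int by (simp add: eq that)
  have abs_i: "(LINT x|?P. \<bar>x i\<bar>) = (LINT x|N. \<bar>x\<bar>)" if "i < n" for i
    using integral_distr[OF m[OF that], of "\<lambda>x. \<bar>x\<bar>"] by (simp add: eq that)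
  have [measurable]: "(\<lambda>x. \<Sum>i<n. x i) \<in> borel_measurable ?P"
    by (intro borel_measurable_sum) auto
  have int_sum: "integrable ?P (\<lambda>x. \<Sum>i<n. x i)"
    by (intro Bochner_Integration.integrable_sum) (auto intro: int_i)
  then show "integrable S (\<lambda>x. x)"
    unfolding S_def by (subst integrable_distr_eq) auto
  have "(LINT x|S. \<bar>x\<bar>) = (LINT x|?P. \<bar>\<Sum>i<n. x i\<bar>)"
    unfolding S_def by (subst integral_distr) auto
  also have "\<dots> \<le> (LINT x|?P. (\<Sum>i<n. \<bar>x i\<bar>))"
    by (intro integral_mono Bochner_Integration.integrable_sum integrable_abs int_sum)
      (auto intro: int_i)
  also have "\<dots> = (\<Sum>i<n. (LINT x|?P. \<bar>x i\<bar>))"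
    by (intro Bochner_Integration.integral_sum integrable_abs int_i) auto
  also have "\<dots> = n * (LINT x|N. \<bar>x\<bar>)"
    by (simp add: abs_i)
  finally show "(LINT x|S. \<bar>x\<bar>) \<le> n * (LINT x|N. \<bar>x\<bar>)" .
qed

text \<open>The joint law is a product measure, so the integral of e^(itx) e^(-ity) factors by
  Fubini. The reflected argument \<open>- t\<close> is why the negative part enters
  \<open>char_TS\<close> at \<open>- z\<close>.\<close>

lemma
  assumes "real_distribution M" "real_distribution N"
  defines "D \<equiv> distr (M \<Otimes>\<^sub>M N) borel (\<lambda>(x, y). x - y)"
  shows real_distribution_distr_diff: "real_distribution D"
    and char_distr_diff: "char D t = char M t * char N (- t)"
proof -
  interpret M: real_distribution M by fact
  interpret N: real_distribution N by fact
  interpret P: pair_prob_space M N ..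
  show "real_distribution D"
    unfolding D_def by (rule P.real_distribution_distr) simp
  have "char D t = (CLINT p|M \<Otimes>\<^sub>M N. iexp (t * fst p) * iexp (- t * snd p))"
    unfolding D_def char_def
    by (subst integral_distr)
      (auto simp: case_prod_unfold ring_distribs simp flip: exp_add intro!: Bochner_Integration.integral_cong)
  also have "\<dots> = (CLINT x|M. CLINT y|N. iexp (t * x) * iexp (- t * y))"
    by (subst P.integral_fst'[symmetric])
      (auto intro!: P.P.integrable_const_bound[where B = 1] simp: norm_mult)
  also have "\<dots> = char M t * char N (- t)"
    by (simp add: char_def)
  finally show "char D t = char M t * char N (- t)" .
qed

text \<open>By Markov's inequality the mass at distance at least K from 0 is at most C / K,
  uniformly in n.\<close>

lemma tight_of_abs_moment_bound:
  assumes rd: "\<And>n. real_distribution (\<mu> n)"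
    and int: "\<And>n. integrable (\<mu> n) (\<lambda>x. x)"
    and bound: "\<And>n. (LINT x|\<mu> n. \<bar>x\<bar>) \<le> C"
  shows "tight \<mu>"
  unfolding tight_def
proof (intro conjI allI impI rd)
  fix \<epsilon> :: real assume \<epsilon>: "\<epsilon> > 0"
  \<comment> \<open>With this radius C / K = C \<epsilon> / (|C| + 1) < \<epsilon> whatever the sign
    of C, and K is positive.\<close>
  define K where "K = (\<bar>C\<bar> + 1) / \<epsilon>"
  have K: "K > 0" using \<epsilon> by (simp add: K_def add_nonneg_pos)
  have "measure (\<mu> n) {-K<..K} > 1 - \<epsilon>" for n
  proof -
    interpret real_distribution "\<mu> n" by (rule rd)
    have "measure (\<mu> n) {x \<in> space (\<mu> n). \<bar>x\<bar> \<ge> K} \<le> (LINT x|\<mu> n. \<bar>x\<bar>) / K"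
      by (rule integral_Markov_inequality_measure[where A = "{}"]) (use int K in auto)
    also have "\<dots> \<le> C / K"
      using bound K by (intro divide_right_mono) auto
    also have "\<dots> < \<epsilon>"
      using \<epsilon> K by (simp add: K_def field_simps) (use \<epsilon> in \<open>simp add: mult_less_cancel_left_pos abs_if\<close>)
    finally have 1: "prob {x. \<bar>x\<bar> \<ge> K} < \<epsilon>" by simp
    have "1 - prob {x. \<bar>x\<bar> \<ge> K} = prob (space (\<mu> n) - {x. \<bar>x\<bar> \<ge> K})"
      by (subst prob_compl) auto
    also have "\<dots> \<le> prob {-K<..K}"
      by (intro finite_measure_mono) auto
    finally show ?thesis using 1 by linarith
  qed
  then show "\<exists>a b. a < b \<and> (\<forall>n. measure (\<mu> n) {a<..b} > 1 - \<epsilon>)"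
    using K by (intro exI[of _ "-K"] exI[of _ K]) auto
qed

subsection \<open>Existence of laws with a given Levy measure\<close>

lemma norm_iexp_minus_1_le: "norm (iexp x - 1) \<le> \<bar>x\<bar>"
  using iexp_approx1[of x 0] by simp

text \<open>Both 1 + \<psi>/c and exp (\<psi>/c) lie in the closed unit disc, so their n-th powers
  differ by at most n times the difference of the bases. That difference is of order 1 / c^2 and n
  \<le> c, so the error is of order 1 / c; the powers of exp (\<psi>/c) converge because n / c tends
  to 1.\<close>

lemma tendsto_one_plus_power_floor:
  fixes \<psi> :: "nat \<Rightarrow> complex" and c :: "nat \<Rightarrow> real"
  assumes c: "filterlim c at_top sequentially" and \<psi>: "\<psi> \<longlonglongrightarrow> L"
    and le1: "\<And>k. norm (1 + \<psi> k / c k) \<le> 1" and Re: "\<And>k. Re (\<psi> k) \<le> 0"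
    and c0: "\<And>k. c k > 0"
  shows "(\<lambda>k. (1 + \<psi> k / c k) ^ nat \<lfloor>c k\<rfloor>) \<longlonglongrightarrow> exp L"
proof -
  let ?n = "\<lambda>k. nat \<lfloor>c k\<rfloor>"
  have inv: "(\<lambda>k. 1 / c k) \<longlonglongrightarrow> 0"
    by (rule tendsto_divide_0[OF tendsto_const filterlim_at_top_imp_at_infinity[OF c]])
  have n_le: "real (?n k) \<le> c k" and n_ge: "c k - 1 \<le> real (?n k)" for k
    using c0[of k] by linarith+
  have ratio: "(\<lambda>k. real (?n k) / c k) \<longlonglongrightarrow> 1"
  proof (rule tendsto_sandwich[where f = "\<lambda>k. 1 - 1 / c k" and h = "\<lambda>_. 1"])
    show "\<forall>\<^sub>F k in sequentially. 1 - 1 / c k \<le> real (?n k) / c k"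
    proof (intro always_eventually allI)
      fix k
      have "1 - 1 / c k = (c k - 1) / c k"
        using c0[of k] by (simp add: diff_divide_distrib)
      also have "\<dots> \<le> real (?n k) / c k"
        using c0[of k] n_ge[of k] by (intro divide_right_mono) auto
      finally show "1 - 1 / c k \<le> real (?n k) / c k" .
    qed
    show "\<forall>\<^sub>F k in sequentially. real (?n k) / c k \<le> 1"
      using n_le c0 by (intro always_eventually allI) (simp add: field_simps)
    show "(\<lambda>k. 1 - 1 / c k) \<longlonglongrightarrow> 1"
      using tendsto_diff[OF tendsto_const inv, of 1] by simp
  qed simp
  have "norm ((1 + \<psi> k / c k) ^ ?n k - exp (\<psi> k / c k) ^ ?n k)
      \<le> exp (norm (\<psi> k * complex_of_real (1 / c k))) * (norm (\<psi> k))\<^sup>2 * (1 / c k)" for k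
  proof -
    let ?w = "\<psi> k / c k"
    have "norm (exp ?w) \<le> 1"
      using Re[of k] c0[of k] by (simp add: divide_nonpos_pos)
    then have "norm ((1 + ?w) ^ ?n k - exp ?w ^ ?n k) \<le> ?n k * norm ((1 + ?w) - exp ?w)"
      by (intro norm_power_diff le1)
    also have "\<dots> \<le> c k * norm ((1 + ?w) - exp ?w)"
      by (intro mult_right_mono n_le) auto
    \<comment> \<open>The remainder of the first-order Taylor polynomial of exp is quadratic in
      \<open>?w\<close>.\<close>
    also have "norm ((1 + ?w) - exp ?w) \<le> exp (norm ?w) * (norm ?w)\<^sup>2"
      using Taylor_exp_field[of ?w 1] by (simp add: norm_minus_commute power2_eq_square)
    also have "c k * (exp (norm ?w) * (norm ?w)\<^sup>2)
        = exp (norm (\<psi> k * complex_of_real (1 / c k))) * (norm (\<psi> k))\<^sup>2 * (1 / c k)"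
      using c0[of k] by (simp add: norm_divide norm_mult power2_eq_square field_simps)
    finally show ?thesis using c0[of k] by (simp add: mult_left_mono)
  qed
  moreover have "(\<lambda>k. exp (norm (\<psi> k * complex_of_real (1 / c k))) * (norm (\<psi> k))\<^sup>2 * (1 / c k)) \<longlonglongrightarrow>
      exp (norm (L * complex_of_real 0)) * (norm L)\<^sup>2 * 0"
    by (intro tendsto_intros \<psi> inv)
  ultimately have diff: "(\<lambda>k. (1 + \<psi> k / c k) ^ ?n k - exp (\<psi> k / c k) ^ ?n k) \<longlonglongrightarrow> 0"
    by (intro Lim_null_comparison[where f = "\<lambda>k. (1 + \<psi> k / c k) ^ ?n k - exp (\<psi> k / c k) ^ ?n k"])
      (auto intro: always_eventually)
  have "(\<lambda>k. exp (\<psi> k * complex_of_real (real (?n k) / c k))) \<longlonglongrightarrow> exp (L * complex_of_real 1)"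
    by (intro tendsto_intros \<psi> ratio)
  then have "(\<lambda>k. exp (\<psi> k / c k) ^ ?n k) \<longlonglongrightarrow> exp L"
    by (simp add: exp_of_nat_mult[symmetric] mult_ac)
  from tendsto_add[OF diff this] show ?thesis by simp
qed

lemma ex_distribution_with_Levy_measure:
  assumes sets_F [measurable_cong]: "sets F = sets borel"
    and int: "integrable F (\<lambda>x. x)" and inf: "emeasure F (- {0 :: real}) = \<infinity>"
  shows "\<exists>M. real_distribution M \<and> (\<forall>z. char M z = exp (CLINT x|F. (iexp (z * x) - 1)))"
proof -
  have space_F [simp]: "space F = UNIV"
    using sets_eq_imp_space_eq[OF sets_F] by simp
  \<comment> \<open>Cutting off the small jumps makes F finite, of mass \<open>c k\<close> tending to infinity. The normalised
    measure \<open>N k\<close> then has characteristic function \<open>1 + \<psi> k / c k\<close>, so that the sum of about \<open>c k\<close>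
    independent copies has the desired one in the limit; no atom at 0 is needed.\<close>
  define g where "g k x = min 1 (real (Suc k) * \<bar>x\<bar>)" for k :: nat and x :: real
  have [measurable]: "g k \<in> borel_measurable borel" for k
    unfolding g_def by measurable
  have g_nonneg: "0 \<le> g k x" and g_le1: "g k x \<le> 1" and g_le: "g k x \<le> real (Suc k) * \<bar>x\<bar>" for k x
    by (auto simp: g_def)
  have int_abs: "integrable F (\<lambda>x. \<bar>x\<bar>)"
    using int by (rule integrable_abs)
  have int_g: "integrable F (g k)" for k
    by (rule Bochner_Integration.integrable_bound[OF integrable_mult_right[OF int_abs, of "real (Suc k)"]])
      (use g_nonneg g_le in \<open>auto simp: abs_mult\<close>)
  have g_lim: "(\<lambda>k. g k x) \<longlonglongrightarrow> 1" if "x \<noteq> 0" for x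
  proof (rule tendsto_eventually)
    have "\<forall>\<^sub>F k in sequentially. 1 / \<bar>x\<bar> \<le> real k"
      using filterlim_real_sequentially by (simp add: filterlim_at_top)
    then show "\<forall>\<^sub>F k in sequentially. g k x = 1"
      by eventually_elim (use that in \<open>auto simp: g_def min_def field_simps\<close>)
  qed
  define c where "c k = (LINT x|F. g k x)" for k
  have g_mono: "g k x \<le> g k' x" if "k \<le> k'" for k k' x
    using that unfolding g_def by (intro min.mono mult_right_mono) auto
  have ennreal_c: "ennreal (c k) = (\<integral>\<^sup>+x. ennreal (g k x) \<partial>F)" for k
    unfolding c_def by (intro nn_integral_eq_integral[symmetric] int_g) (simp add: g_nonneg)
  have SUP_g: "(SUP k. ennreal (g k x)) = indicator (- {0}) x" for x
  proof (cases "x = 0")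
    case False
    have "(\<lambda>k. ennreal (g k x)) \<longlonglongrightarrow> ennreal 1"
      using False by (intro tendsto_ennrealI g_lim)
    moreover have "incseq (\<lambda>k. ennreal (g k x))"
      by (auto simp: incseq_def intro!: ennreal_leI g_mono)
    ultimately show ?thesis
      using LIMSEQ_unique[OF LIMSEQ_SUP] False by auto
  qed (simp add: g_def)
  \<comment> \<open>Monotone convergence turns the infinite mass of F outside 0 into unboundedness
    of c; as c is increasing, it then tends to infinity.\<close>
  have "(SUP k. ennreal (c k)) = (\<integral>\<^sup>+x. (SUP k. ennreal (g k x)) \<partial>F)"
    unfolding ennreal_c by (intro nn_integral_monotone_convergence_SUP[symmetric])
      (auto simp: incseq_def le_fun_def intro!: ennreal_leI g_mono)
  also have "\<dots> = \<infinity>"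
    by (simp add: SUP_g inf)
  finally have SUP_c: "(SUP k. ennreal (c k)) = \<infinity>" .
  have c_mono: "c k \<le> c k'" if "k \<le> k'" for k k'
    unfolding c_def using that by (intro integral_mono int_g g_mono)
  have c_top: "filterlim c at_top sequentially"
    unfolding filterlim_at_top
  proof
    fix Z :: real
    have "ennreal Z < (SUP k. ennreal (c k))"
      by (simp add: SUP_c)
    then obtain k where "ennreal Z < ennreal (c k)"
      by (auto simp: less_SUP_iff)
    then have "Z \<le> c k"
      by (metis ennreal_leI leD linear)
    then show "\<forall>\<^sub>F k in sequentially. Z \<le> c k"
      using c_mono by (auto simp: eventually_sequentially intro: order_trans)
  qed
  \<comment> \<open>\<open>g k\<close> vanishes only at 0, so c k = 0 would leave F without mass
    outside 0. Positivity for every k permits the normalisation in \<open>N\<close>.\<close>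
  have c_pos: "c k > 0" for k
  proof (rule ccontr)
    assume "\<not> c k > 0"
    then have "(\<integral>\<^sup>+x. ennreal (g k x) \<partial>F) = 0"
      by (simp add: ennreal_c[symmetric] ennreal_neg)
    then have "AE x in F. ennreal (g k x) = 0"
      by (subst (asm) nn_integral_0_iff_AE) auto
    then have "AE x in F. x \<notin> - {0}"
      by eventually_elim (auto simp: g_def min_def ennreal_eq_0_iff mult_le_0_iff split: if_splits)
    then have "emeasure F (- {0}) = 0"
      by (subst (asm) AE_iff_measurable[OF _ refl]) (auto simp: Collect_neg_eq)
    then show False using inf by simp
  qed

  define N where "N k = density F (\<lambda>x. ennreal (g k x / c k))" for k
  have N_nonneg: "0 \<le> g k x / c k" for k x
    using g_nonneg c_pos by (simp add: less_imp_le)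
  have rd_N: "real_distribution (N k)" for k
  proof -
    have "emeasure (N k) (space (N k)) = (\<integral>\<^sup>+x. ennreal (g k x / c k) \<partial>F)"
      unfolding N_def by (simp add: emeasure_density)
    also have "\<dots> = ennreal (LINT x|F. g k x / c k)"
      using int_g N_nonneg by (intro nn_integral_eq_integral) auto
    also have "\<dots> = 1"
      using c_pos[of k] by (simp add: c_def)
    finally show ?thesis
      by (auto simp: real_distribution_def real_distribution_axioms_def N_def sets_F intro: prob_spaceI)
  qed
  have int_N: "integrable (N k) (\<lambda>x. x)" and mean_N: "(LINT x|N k. \<bar>x\<bar>) \<le> (LINT x|F. \<bar>x\<bar>) / c k" for k
  proof -
    have bnd: "\<bar>g k x / c k * x\<bar> \<le> \<bar>x\<bar> / c k" for x
      using g_nonneg[of k x] g_le1[of k x] c_pos[of k]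
      by (auto simp: abs_mult field_simps intro!: mult_left_le_one_le mult_right_le_one_le)
    have int': "integrable F (\<lambda>x. g k x / c k * x)"
      by (rule Bochner_Integration.integrable_bound[OF integrable_divide[OF int_abs, of "c k"]])
        (use bnd c_pos[of k] in auto)
    then show "integrable (N k) (\<lambda>x. x)"
      unfolding N_def using N_nonneg by (subst integrable_density) auto
    have "(LINT x|N k. \<bar>x\<bar>) = (LINT x|F. \<bar>g k x / c k * x\<bar>)"
      unfolding N_def using N_nonneg[of k] c_pos[of k] g_nonneg[of k]
      by (subst integral_density) (auto simp: abs_mult)
    also have "\<dots> \<le> (LINT x|F. \<bar>x\<bar> / c k)"
      using int' int_abs bnd by (intro integral_mono integrable_abs) auto
    also have "\<dots> = (LINT x|F. \<bar>x\<bar>) / c k"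
      by simp
    finally show "(LINT x|N k. \<bar>x\<bar>) \<le> (LINT x|F. \<bar>x\<bar>) / c k" .
  qed

  define n where "n k = nat \<lfloor>c k\<rfloor>" for k
  define S where "S k = distr (Pi\<^sub>M {..<n k} (\<lambda>_. N k)) borel (\<lambda>x. \<Sum>i<n k. x i)" for k
  have rd_S: "real_distribution (S k)" for k
    unfolding S_def by (rule real_distribution_iid_sum[OF rd_N])
  have "tight S"
  proof (rule tight_of_abs_moment_bound)
    fix k
    show "real_distribution (S k)"
      by (rule rd_S)
    show "integrable (S k) (\<lambda>x. x)"
      unfolding S_def by (rule integrable_iid_sum[OF rd_N int_N])
    have "(LINT x|S k. \<bar>x\<bar>) \<le> n k * (LINT x|N k. \<bar>x\<bar>)"
      unfolding S_def by (rule expectation_abs_iid_sum_le[OF rd_N int_N])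
    also have "\<dots> \<le> n k * ((LINT x|F. \<bar>x\<bar>) / c k)"
      by (intro mult_left_mono mean_N) auto
    \<comment> \<open>The number of summands is at most c k, which cancels the normalising factor
      and leaves a bound independent of k.\<close>
    also have "\<dots> \<le> c k * ((LINT x|F. \<bar>x\<bar>) / c k)"
    proof (intro mult_right_mono)
      show "real (n k) \<le> c k" using c_pos[of k] unfolding n_def by linarith
    qed (use c_pos[of k] in auto)
    also have "\<dots> = (LINT x|F. \<bar>x\<bar>)"
      using c_pos[of k] by simp
    finally show "(LINT x|S k. \<bar>x\<bar>) \<le> (LINT x|F. \<bar>x\<bar>)" .
  qed
  \<comment> \<open>Tightness yields a weak limit along a subsequence only. This suffices: the
    characteristic functions converge along the whole sequence, so the subsequence inherits their
    limit.\<close>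
  from tight_imp_convergent_subsubsequence[OF this strict_mono_id]
  obtain r M where r: "strict_mono r" and M: "real_distribution M" "weak_conv_m (S \<circ> id \<circ> r) M"
    by blast

  have "char M z = exp (CLINT x|F. (iexp (z * x) - 1))" for z
  proof -
    define \<psi> where "\<psi> k = (CLINT x|F. complex_of_real (g k x) * (iexp (z * x) - 1))" for k
    have int_zabs: "integrable F (\<lambda>x. \<bar>z * x\<bar>)"
      using int by (intro integrable_abs integrable_mult_right)
    have bnd: "norm (complex_of_real (g k x) * (iexp (z * x) - 1)) \<le> \<bar>z * x\<bar>" for k x
    proof -
      have "g k x * norm (iexp (z * x) - 1) \<le> 1 * \<bar>z * x\<bar>"
        using norm_iexp_minus_1_le[of "z * x"] g_nonneg g_le1 by (intro mult_mono) auto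
      then show ?thesis
        using g_nonneg[of k x] by (simp add: norm_mult)
    qed
    have int_\<psi>: "integrable F (\<lambda>x. complex_of_real (g k x) * (iexp (z * x) - 1))" for k
      by (rule Bochner_Integration.integrable_bound[OF int_zabs]) (use bnd in auto)
    have lim: "\<psi> \<longlonglongrightarrow> (CLINT x|F. (iexp (z * x) - 1))"
      unfolding \<psi>_def
    proof (rule integral_dominated_convergence[OF _ _ int_zabs])
      show "AE x in F. (\<lambda>k. complex_of_real (g k x) * (iexp (z * x) - 1)) \<longlonglongrightarrow> iexp (z * x) - 1"
      proof (rule AE_I2)
        fix x
        show "(\<lambda>k. complex_of_real (g k x) * (iexp (z * x) - 1)) \<longlonglongrightarrow> iexp (z * x) - 1"
        \<comment> \<open>At x = 0 the cutoff stays 0 instead of tending to 1, but the factor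
          e^(izx) - 1 vanishes there.\<close>
        proof (cases "x = 0")
          case False
          then have "(\<lambda>k. complex_of_real (g k x) * (iexp (z * x) - 1)) \<longlonglongrightarrow> complex_of_real 1 * (iexp (z * x) - 1)"
            by (intro tendsto_intros g_lim)
          then show ?thesis by simp
        qed simp
      qed
    qed (use bnd in auto)
    have char_N: "char (N k) z = 1 + \<psi> k / c k" for k
    proof -
      \<comment> \<open>Writing e^(izx) = 1 + (e^(izx) - 1) under the integral, the first summand
        contributes the mass c k of the cut-off measure and the second contributes
        \<open>\<psi> k\<close>.\<close>
      have "char (N k) z = (CLINT x|F. (complex_of_real (g k x) + complex_of_real (g k x) * (iexp (z * x) - 1)) / c k)"
        unfolding char_def N_def using N_nonneg
        by (subst integral_density)
          (auto simp: scaleR_conv_of_real field_simps intro!: Bochner_Integration.integral_cong)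
      also have "\<dots> = ((CLINT x|F. complex_of_real (g k x)) + \<psi> k) / c k"
        using int_g int_\<psi> by (simp add: \<psi>_def)
      also have "(CLINT x|F. complex_of_real (g k x)) = c k"
        by (simp add: c_def)
      finally show ?thesis
        using c_pos[of k] by (simp add: add_divide_distrib)
    qed
    have Re: "Re (\<psi> k) \<le> 0" for k
    proof -
      have "Re (\<psi> k) = (LINT x|F. g k x * (cos (z * x) - 1))"
        using integral_Re[OF int_\<psi>[of k]] by (simp add: \<psi>_def Re_exp)
      also have "\<dots> \<le> (LINT x|F. 0)"
        using integrable_Re[OF int_\<psi>[of k]] g_nonneg
        by (intro integral_mono) (auto simp: Re_exp mult_le_0_iff)
      finally show ?thesis by simp
    qed
    \<comment> \<open>The unit disc condition holds because \<open>1 + \<psi> k / c k\<close> is a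
      value of the characteristic function of \<open>N k\<close>.\<close>
    have "(\<lambda>k. (1 + \<psi> k / c k) ^ n k) \<longlonglongrightarrow> exp (CLINT x|F. (iexp (z * x) - 1))"
      unfolding n_def
      by (rule tendsto_one_plus_power_floor[OF c_top lim])
        (use Re c_pos real_distribution.cmod_char_le_1[OF rd_N] in \<open>auto simp flip: char_N\<close>)
    then have "(\<lambda>k. char (S k) z) \<longlonglongrightarrow> exp (CLINT x|F. (iexp (z * x) - 1))"
      unfolding S_def by (simp add: char_iid_sum[OF rd_N] char_N)
    from LIMSEQ_subseq_LIMSEQ[OF this r]
    have "(\<lambda>k. char ((S \<circ> id \<circ> r) k) z) \<longlonglongrightarrow> exp (CLINT x|F. (iexp (z * x) - 1))"
      by (simp add: comp_def)
    moreover have "(\<lambda>k. char ((S \<circ> id \<circ> r) k) z) \<longlonglongrightarrow> char M z"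
      by (rule levy_continuity1[OF _ M]) (simp add: rd_S)
    ultimately show ?thesis
      by (rule LIMSEQ_unique[rotated])
  qed
  with M(1) show ?thesis by blast
qed

subsection \<open>Tempered stable laws\<close>

lemma has_bochner_integral_Gamma_scaled:
  fixes s l :: real
  assumes s: "s > 0" and l: "l > 0"
  shows "has_bochner_integral lborel (\<lambda>x. x powr (s - 1) * exp (- l * x) * indicator {0<..} x) (Gamma s / l powr s)"
proof -
  define f :: "real \<Rightarrow> real" where "f x = x powr (s - 1) * exp (- x) * indicator {0<..} x" for x
  have "(\<integral>\<^sup>+x. ennreal (f x) \<partial>lborel) = (\<integral>\<^sup>+x. ennreal (indicator {0..} x * x powr (s - 1) / exp x) \<partial>lborel)"
    by (intro nn_integral_cong) (auto simp: f_def exp_minus field_simps split: split_indicator)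
  also have "\<dots> = ennreal (Gamma s)"
    using Gamma_conv_nn_integral_real[OF s] by simp
  finally have "has_bochner_integral lborel f (Gamma s)"
    using s by (intro has_bochner_integral_nn_integral) (auto simp: f_def[abs_def] Gamma_real_nonneg)
  \<comment> \<open>Euler's integral under the affine substitution x -> 0 + l x; dividing by l^(s-1)
    afterwards removes the power of l produced by (l x)^(s-1).\<close>
  then have "has_bochner_integral lborel (\<lambda>x. f (0 + l * x)) (Gamma s /\<^sub>R \<bar>l\<bar>)"
    using l by (subst lborel_has_bochner_integral_real_affine_iff[symmetric]) auto
  then have "has_bochner_integral lborel (\<lambda>x. f (0 + l * x) * (1 / l powr (s - 1))) ((Gamma s /\<^sub>R \<bar>l\<bar>) * (1 / l powr (s - 1)))"
    by (rule has_bochner_integral_mult_left)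
  also have "(\<lambda>x. f (0 + l * x) * (1 / l powr (s - 1))) = (\<lambda>x. x powr (s - 1) * exp (- l * x) * indicator {0<..} x)"
    using l by (auto simp: f_def powr_mult zero_less_mult_iff fun_eq_iff split: split_indicator)
  also have "(Gamma s /\<^sub>R \<bar>l\<bar>) * (1 / l powr (s - 1)) = Gamma s / l powr s"
    using l by (simp add: powr_diff field_simps)
  finally show ?thesis .
qed

definition ts_levy_density :: "real \<Rightarrow> real \<Rightarrow> real \<Rightarrow> real \<Rightarrow> real" where
  "ts_levy_density \<alpha> \<beta> l x = \<alpha> / x powr (1 + \<beta>) * exp (- l * x) * indicator {0<..} x"

text \<open>Integrating over Lebesgue measure puts all parameters into the integrand, so that
  dominated convergence applies when they vary.\<close>

definition ts_exponent :: "real \<Rightarrow> real \<Rightarrow> real \<Rightarrow> real \<Rightarrow> complex" where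
  "ts_exponent \<alpha> \<beta> l z = (CLBINT x. complex_of_real (ts_levy_density \<alpha> \<beta> l x) * (iexp (z * x) - 1))"

lemma ts_levy_density_measurable [measurable]: "ts_levy_density \<alpha> \<beta> l \<in> borel_measurable borel"
  unfolding ts_levy_density_def by measurable

lemma ts_levy_density_nonneg: "\<alpha> \<ge> 0 \<Longrightarrow> 0 \<le> ts_levy_density \<alpha> \<beta> l x"
  by (simp add: ts_levy_density_def)

lemma ts_levy_measure_eq: "ts_levy_measure \<alpha> \<beta> l = density lborel (\<lambda>x. ennreal (ts_levy_density \<alpha> \<beta> l x))"
  unfolding ts_levy_measure_def ts_levy_density_def ..

lemma sets_ts_levy_measure: "sets (ts_levy_measure \<alpha> \<beta> l) = sets borel"
  by (simp add: ts_levy_measure_def)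

lemma integral_ts_levy_measure:
  assumes "\<alpha> \<ge> 0"
  shows "(CLINT x|ts_levy_measure \<alpha> \<beta> l. (iexp (z * x) - 1)) = ts_exponent \<alpha> \<beta> l z"
  unfolding ts_levy_measure_eq ts_exponent_def using assms
  by (subst integral_density) (auto simp: ts_levy_density_nonneg scaleR_conv_of_real)

text \<open>The factor x^k turns the singularity into x^(k-\<beta>-1), which is a Gamma integral
  with s = k - \<beta>; this is positive since \<beta> < 1 \<le> k.\<close>

lemma ts_levy_density_moment:
  fixes k :: nat and \<alpha> \<beta> l :: real
  assumes "k \<ge> 1" "\<beta> < 1" "l > 0"
  shows "has_bochner_integral lborel (\<lambda>x. ts_levy_density \<alpha> \<beta> l x * x ^ k)
    (Gamma (k - \<beta>) * (\<alpha> / l powr (k - \<beta>)))"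
proof -
  have "has_bochner_integral lborel (\<lambda>x. \<alpha> * (x powr ((k - \<beta>) - 1) * exp (- l * x) * indicator {0<..} x))
      (\<alpha> * (Gamma (k - \<beta>) / l powr (k - \<beta>)))"
    using has_bochner_integral_Gamma_scaled[of "k - \<beta>" l] assms
    by (intro has_bochner_integral_mult_right) simp
  also have "(\<lambda>x. \<alpha> * (x powr ((k - \<beta>) - 1) * exp (- l * x) * indicator {0<..} x))
      = (\<lambda>x. ts_levy_density \<alpha> \<beta> l x * x ^ k)"
  proof
    fix x :: real
    have "x powr ((k - \<beta>) - 1) = x ^ k / x powr (1 + \<beta>)" if "x > 0"
      using that by (simp add: powr_diff powr_add powr_realpow field_simps)
    then show "\<alpha> * (x powr ((k - \<beta>) - 1) * exp (- l * x) * indicator {0<..} x) = ts_levy_density \<alpha> \<beta> l x * x ^ k"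
      by (auto simp: ts_levy_density_def split: split_indicator)
  qed
  finally show ?thesis by (simp add: mult_ac)
qed

lemma ts_exponent_integrable:
  assumes "\<beta> < 1" "l > 0"
  shows "integrable lborel (\<lambda>x. complex_of_real (ts_levy_density \<alpha> \<beta> l x) * (iexp (z * x) - 1))"
proof (rule Bochner_Integration.integrable_bound)
  show "integrable lborel (\<lambda>x. z * (ts_levy_density \<alpha> \<beta> l x * x ^ 1))"
    using ts_levy_density_moment[where k = 1 and \<beta> = \<beta> and l = l and \<alpha> = \<alpha>] assms
    by (intro integrable_mult_right) (auto simp: has_bochner_integral_iff)
  show "AE x in lborel. norm (complex_of_real (ts_levy_density \<alpha> \<beta> l x) * (iexp (z * x) - 1))
      \<le> norm (z * (ts_levy_density \<alpha> \<beta> l x * x ^ 1))"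
  proof (rule AE_I2)
    fix x
    have "\<bar>ts_levy_density \<alpha> \<beta> l x\<bar> * norm (iexp (z * x) - 1) \<le> \<bar>ts_levy_density \<alpha> \<beta> l x\<bar> * \<bar>z * x\<bar>"
      by (intro mult_left_mono norm_iexp_minus_1_le) auto
    then show "norm (complex_of_real (ts_levy_density \<alpha> \<beta> l x) * (iexp (z * x) - 1))
      \<le> norm (z * (ts_levy_density \<alpha> \<beta> l x * x ^ 1))"
      by (simp add: norm_mult abs_mult mult_ac)
  qed
qed simp

text \<open>Linearity in \<alpha>. It shows that the n-th convolution root of a tempered stable law
  is the one with \<alpha> / n in place of \<alpha>.\<close>

lemma ts_exponent_divide: "ts_exponent (\<alpha> / c) \<beta> l z = ts_exponent \<alpha> \<beta> l z / c"
proof -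
  have "ts_exponent (\<alpha> / c) \<beta> l z
      = (CLBINT x. complex_of_real (ts_levy_density \<alpha> \<beta> l x) * (iexp (z * x) - 1) / c)"
    unfolding ts_exponent_def ts_levy_density_def by (intro Bochner_Integration.integral_cong) auto
  then show ?thesis by (simp add: ts_exponent_def)
qed

text \<open>On (0, 1] the density is at least \<alpha> e^(-l) / x, because \<beta> \<ge> 0 gives
  x^(1+\<beta>) \<le> x there, and 1 / x has a divergent integral at 0.\<close>

lemma emeasure_ts_levy_measure_infinite:
  assumes \<alpha>: "\<alpha> > 0" and "0 \<le> \<beta>" "l > 0"
  shows "emeasure (ts_levy_measure \<alpha> \<beta> l) (- {0}) = \<infinity>"
proof -
  let ?C = "\<alpha> * exp (- l)"
  have C: "?C > 0" using \<alpha> by simp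
  have ge: "ennreal (?C * y) \<le> emeasure (ts_levy_measure \<alpha> \<beta> l) (- {0})" if y: "y \<ge> 0" for y
  proof -
    \<comment> \<open>The integral of 1 / x from e^(-y) to 1 is exactly y, so the lower bound
      \<open>?C * y\<close> can be made arbitrarily large.\<close>
    let ?e = "exp (- y)"
    have e: "?e \<le> 1" using y by simp
    have pos: "x > 0" if "?e \<le> x" for x
      using that exp_gt_zero[of "- y"] by linarith
    have "(\<integral>\<^sup>+x. ennreal (?C / x) * indicator {?e..1} x \<partial>lborel) = ennreal (?C * ln 1 - ?C * ln ?e)"
      using e C pos
      by (intro nn_integral_FTC_Icc[where F = "\<lambda>x. ?C * ln x"])
        (auto intro!: derivative_eq_intros divide_nonneg_pos simp: less_imp_le dest!: pos)
    then have "ennreal (?C * y) = (\<integral>\<^sup>+x. ennreal (?C / x) * indicator {?e..1} x \<partial>lborel)"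
      by simp
    also have "\<dots> \<le> (\<integral>\<^sup>+x. ennreal (ts_levy_density \<alpha> \<beta> l x) * indicator (- {0}) x \<partial>lborel)"
    proof (rule nn_integral_mono)
      fix x :: real
      show "ennreal (?C / x) * indicator {?e..1} x \<le> ennreal (ts_levy_density \<alpha> \<beta> l x) * indicator (- {0}) x"
      proof (cases "x \<in> {?e..1}")
        case True
        then have x: "0 < x" "x \<le> 1" using pos by auto
        have "x powr (1 + \<beta>) \<le> x powr 1"
          using x assms by (intro powr_mono') auto
        moreover have "exp (- l) \<le> exp (- l * x)"
          using x assms by simp
        ultimately have "\<alpha> / x * exp (- l) \<le> \<alpha> / x powr (1 + \<beta>) * exp (- l * x)"
          using x \<alpha> by (intro mult_mono divide_left_mono) auto
        then show ?thesis
          using x True by (auto simp: ts_levy_density_def intro!: ennreal_leI)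
      qed simp
    qed
    also have "\<dots> = emeasure (ts_levy_measure \<alpha> \<beta> l) (- {0})"
      unfolding ts_levy_measure_eq by (subst emeasure_density) auto
    finally show ?thesis .
  qed
  have "ennreal r \<le> emeasure (ts_levy_measure \<alpha> \<beta> l) (- {0})" for r
  proof (cases "r \<ge> 0")
    case True
    then show ?thesis
      using ge[of "r / ?C"] C \<alpha> by (simp add: divide_nonneg_pos)
  qed (simp add: ennreal_neg)
  note le = this
  show ?thesis
  proof (cases "emeasure (ts_levy_measure \<alpha> \<beta> l) (- {0})")
    case (real r)
    then show ?thesis
      using le[of "r + 1"] by (simp add: ennreal_le_iff)
  qed simp
qed

section \<open>Existence, uniqueness and infinite divisibility of the one-sided laws\<close>

lemma ex_ts_distribution:
  assumes "\<alpha> > 0" "0 \<le> \<beta>" "\<beta> < 1" "l > 0"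
  shows "\<exists>M. real_distribution M \<and> (\<forall>z. char M z = exp (ts_exponent \<alpha> \<beta> l z))"
proof -
  have "integrable (ts_levy_measure \<alpha> \<beta> l) (\<lambda>x. x)"
    unfolding ts_levy_measure_eq using assms ts_levy_density_moment[where k = 1 and \<beta> = \<beta> and l = l and \<alpha> = \<alpha>]
    by (subst integrable_density) (auto simp: ts_levy_density_nonneg has_bochner_integral_iff)
  from ex_distribution_with_Levy_measure[OF sets_ts_levy_measure this] show ?thesis
    using assms by (simp only: integral_ts_levy_measure emeasure_ts_levy_measure_infinite less_imp_le)
qed

text \<open>Gives meaning to the definite description in \<open>one_sided_TS\<close>: a law with the
  prescribed characteristic function exists, Levy's theorem makes it unique, and its convolution
  roots are obtained by dividing \<alpha> by n.\<close>

lemma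
  assumes "(\<alpha>, \<beta>, l) \<in> ts_parameters"
  shows real_distribution_one_sided_TS: "real_distribution (one_sided_TS \<alpha> \<beta> l)"
    and char_one_sided_TS: "char (one_sided_TS \<alpha> \<beta> l) z = exp (ts_exponent \<alpha> \<beta> l z)"
proof -
  have par: "\<alpha> > 0" "0 \<le> \<beta>" "\<beta> < 1" "l > 0"
    using assms by (auto simp: ts_parameters_def)
  have exponent: "(CLINT x|ts_levy_measure \<alpha> \<beta> l. (iexp (z * x) - 1)) = ts_exponent \<alpha> \<beta> l z" for z
    using par by (intro integral_ts_levy_measure) simp
  obtain M where M: "real_distribution M" "\<And>z. char M z = exp (ts_exponent \<alpha> \<beta> l z)"
    using ex_ts_distribution par by blast
  have "infinitely_divisible M"
    unfolding infinitely_divisible_def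
  proof (intro allI impI)
    fix n :: nat assume n: "n \<ge> 1"
    then obtain N where N: "real_distribution N" "\<And>z. char N z = exp (ts_exponent (\<alpha> / n) \<beta> l z)"
      using ex_ts_distribution[of "\<alpha> / n" \<beta> l] par by auto
    have "char M = char (distr (Pi\<^sub>M {..<n} (\<lambda>_. N)) borel (\<lambda>x. \<Sum>i<n. x i))"
      using n by (auto simp: char_iid_sum[OF N(1)] M N ts_exponent_divide fun_eq_iff simp flip: exp_of_nat_mult)
    then show "\<exists>N. real_distribution N \<and> M = distr (Pi\<^sub>M {..<n} (\<lambda>_. N)) borel (\<lambda>x. \<Sum>i<n. x i)"
      using Levy_uniqueness[OF M(1) real_distribution_iid_sum[OF N(1)]] N(1) by blast
  qed
  then have "one_sided_TS \<alpha> \<beta> l = M"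
    unfolding one_sided_TS_def exponent using M
    by (intro the_equality) (auto intro!: Levy_uniqueness)
  then show "real_distribution (one_sided_TS \<alpha> \<beta> l)"
    and "char (one_sided_TS \<alpha> \<beta> l) z = exp (ts_exponent \<alpha> \<beta> l z)"
    using M by auto
qed

lemma
  assumes "(\<alpha>p, \<beta>p, lp) \<in> ts_parameters" "(\<alpha>m, \<beta>m, lm) \<in> ts_parameters"
  shows real_distribution_TS: "real_distribution (TS \<alpha>p \<beta>p lp \<alpha>m \<beta>m lm)"
    and char_TS: "char (TS \<alpha>p \<beta>p lp \<alpha>m \<beta>m lm) z = exp (ts_exponent \<alpha>p \<beta>p lp z + ts_exponent \<alpha>m \<beta>m lm (- z))"
  unfolding TS_def using assms
  by (simp_all add: real_distribution_distr_diff char_distr_diff real_distribution_one_sided_TS char_one_sided_TS exp_add)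

subsection \<open>Limits of the exponents\<close>

text \<open>The k-th moment of the Levy measure, for k \<ge> 1. The cases k = 1 and k = 2 are the
  quantities whose limits are prescribed in statements (4) and (5).\<close>

definition ts_moment :: "nat \<Rightarrow> real \<Rightarrow> real \<Rightarrow> real \<Rightarrow> real" where
  "ts_moment k \<alpha> \<beta> l = Gamma (k - \<beta>) * (\<alpha> / l powr (k - \<beta>))"

text \<open>Integrates the Taylor expansion of e^(izx) against the Levy density; the pointwise
  remainder bound |zx|^(n+1) / (n+1)! integrates to the next moment.\<close>

lemma ts_exponent_Taylor:
  assumes "\<alpha> \<ge> 0" "\<beta> < 1" "l > 0"
  shows "norm (ts_exponent \<alpha> \<beta> l z - (\<Sum>k=1..n. (\<i> * z) ^ k / fact k * ts_moment k \<alpha> \<beta> l))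
    \<le> \<bar>z\<bar> ^ Suc n / fact (Suc n) * ts_moment (Suc n) \<alpha> \<beta> l"
proof -
  let ?d = "ts_levy_density \<alpha> \<beta> l"
  have moment: "has_bochner_integral lborel (\<lambda>x. ?d x * x ^ k) (ts_moment k \<alpha> \<beta> l)" if "k \<ge> 1" for k
    unfolding ts_moment_def using that assms by (intro ts_levy_density_moment)
  define R where "R x = iexp (z * x) - (\<Sum>k\<le>n. (\<i> * complex_of_real (z * x)) ^ k / fact k)" for x
  have "has_bochner_integral lborel (\<lambda>x. complex_of_real (?d x) * (iexp (z * x) - 1)
       - (\<Sum>k=1..n. (\<i> * z) ^ k / fact k * complex_of_real (?d x * x ^ k)))
     (ts_exponent \<alpha> \<beta> l z - (\<Sum>k=1..n. (\<i> * z) ^ k / fact k * ts_moment k \<alpha> \<beta> l))"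
    by (intro has_bochner_integral_diff has_bochner_integral_sum has_bochner_integral_mult_right
        has_bochner_integral_of_real moment)
      (use ts_exponent_integrable assms in \<open>auto simp: has_bochner_integral_iff ts_exponent_def\<close>)
  also have "(\<lambda>x. complex_of_real (?d x) * (iexp (z * x) - 1)
       - (\<Sum>k=1..n. (\<i> * z) ^ k / fact k * complex_of_real (?d x * x ^ k))) = (\<lambda>x. complex_of_real (?d x) * R x)"
  proof
    fix x
    \<comment> \<open>The constant term of the Taylor polynomial is the 1 subtracted in the
      exponent, so the sum of moments starts at k = 1.\<close>
    have "(\<Sum>k\<le>n. (\<i> * complex_of_real (z * x)) ^ k / fact k) = 1 + (\<Sum>k=1..n. (\<i> * complex_of_real (z * x)) ^ k / fact k)"
      by (simp add: atMost_atLeast0 sum.atLeast_Suc_atMost)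
    then show "complex_of_real (?d x) * (iexp (z * x) - 1)
       - (\<Sum>k=1..n. (\<i> * z) ^ k / fact k * complex_of_real (?d x * x ^ k)) = complex_of_real (?d x) * R x"
      by (simp add: R_def algebra_simps sum_distrib_left power_mult_distrib)
  qed
  finally have R: "has_bochner_integral lborel (\<lambda>x. complex_of_real (?d x) * R x)
     (ts_exponent \<alpha> \<beta> l z - (\<Sum>k=1..n. (\<i> * z) ^ k / fact k * ts_moment k \<alpha> \<beta> l))" .
  then have "norm (ts_exponent \<alpha> \<beta> l z - (\<Sum>k=1..n. (\<i> * z) ^ k / fact k * ts_moment k \<alpha> \<beta> l))
      = norm (CLBINT x. complex_of_real (?d x) * R x)"
    by (simp add: has_bochner_integral_iff)
  also have "\<dots> \<le> (LBINT x. norm (complex_of_real (?d x) * R x))"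
    by (rule integral_norm_bound)
  also have "\<dots> \<le> (LBINT x. \<bar>z\<bar> ^ Suc n / fact (Suc n) * (?d x * x ^ Suc n))"
  proof (rule integral_mono)
    show "integrable lborel (\<lambda>x. norm (complex_of_real (?d x) * R x))"
      using R by (intro integrable_norm) (simp add: has_bochner_integral_iff)
    show "integrable lborel (\<lambda>x. \<bar>z\<bar> ^ Suc n / fact (Suc n) * (?d x * x ^ Suc n))"
      using moment[of "Suc n"] by (intro integrable_mult_right) (simp add: has_bochner_integral_iff)
    fix x :: real
    show "norm (complex_of_real (?d x) * R x) \<le> \<bar>z\<bar> ^ Suc n / fact (Suc n) * (?d x * x ^ Suc n)"
    proof (cases "x > 0")
      case True
      have "norm (R x) \<le> \<bar>z * x\<bar> ^ Suc n / fact (Suc n)"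
        unfolding R_def by (rule iexp_approx1)
      then have "?d x * norm (R x) \<le> ?d x * (\<bar>z * x\<bar> ^ Suc n / fact (Suc n))"
        using assms by (intro mult_left_mono) (auto simp: ts_levy_density_nonneg)
      then show ?thesis
        using True assms by (simp add: norm_mult ts_levy_density_nonneg abs_mult power_mult_distrib mult_ac)
    qed (simp add: ts_levy_density_def)
  qed
  also have "\<dots> = \<bar>z\<bar> ^ Suc n / fact (Suc n) * ts_moment (Suc n) \<alpha> \<beta> l"
    using moment[of "Suc n"] by (simp add: has_bochner_integral_iff del: fact_Suc power_Suc)
  finally show ?thesis .
qed

text \<open>The functional equation of Gamma at k - \<beta> > 0. Each further moment gains a factor
  1 / l, which makes remainders vanish as l tends to infinity.\<close>

lemma ts_moment_Suc:
  assumes "k \<ge> 1" "\<beta> < 1" "l > 0"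
  shows "ts_moment (Suc k) \<alpha> \<beta> l = (k - \<beta>) * ts_moment k \<alpha> \<beta> l / l"
proof -
  have "k - \<beta> \<notin> \<int>\<^sub>\<le>\<^sub>0"
    using assms by (auto elim!: nonpos_Ints_cases)
  then have "Gamma ((k - \<beta>) + 1) = (k - \<beta>) * Gamma (k - \<beta>)"
    by (rule Gamma_plus1)
  moreover have "l powr ((k - \<beta>) + 1) = l powr (k - \<beta>) * l"
    using assms by (simp add: powr_add)
  moreover have "real (Suc k) - \<beta> = (k - \<beta>) + 1" by simp
  ultimately have "ts_moment (Suc k) \<alpha> \<beta> l
      = ((k - \<beta>) * Gamma (k - \<beta>)) * (\<alpha> / (l powr (k - \<beta>) * l))"
    by (simp only: ts_moment_def)
  then show ?thesis
    by (simp add: ts_moment_def)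
qed

text \<open>Only the moment of the highest order k is assumed to converge. This matters for the
  normal limit, where the second moments converge but each first moment diverges.\<close>

lemma ts_exponent_remainder_tendsto_0:
  fixes k :: nat
  assumes k: "k \<ge> 1" and \<beta>: "\<beta> < 1" and \<alpha>: "\<And>n. \<alpha> n \<ge> 0" and l: "\<And>n. l n > 0"
    and l_top: "filterlim l at_top sequentially" and lim: "(\<lambda>n. ts_moment k (\<alpha> n) \<beta> (l n)) \<longlonglongrightarrow> L"
  shows "(\<lambda>n. ts_exponent (\<alpha> n) \<beta> (l n) z - (\<Sum>j=1..k. (\<i> * z) ^ j / fact j * ts_moment j (\<alpha> n) \<beta> (l n))) \<longlonglongrightarrow> 0"
proof (rule Lim_null_comparison[OF always_eventually], rule allI)
  fix n
  show "norm (ts_exponent (\<alpha> n) \<beta> (l n) z - (\<Sum>j=1..k. (\<i> * z) ^ j / fact j * ts_moment j (\<alpha> n) \<beta> (l n)))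
      \<le> \<bar>z\<bar> ^ Suc k / fact (Suc k) * ((k - \<beta>) * ts_moment k (\<alpha> n) \<beta> (l n) / l n)"
    using ts_exponent_Taylor[of "\<alpha> n" \<beta> "l n" z k] \<alpha> l by (simp only: ts_moment_Suc[OF k \<beta> l] \<beta>)
next
  have "(\<lambda>n. \<bar>z\<bar> ^ Suc k / fact (Suc k) * ((k - \<beta>) * ts_moment k (\<alpha> n) \<beta> (l n) / l n))
      \<longlonglongrightarrow> \<bar>z\<bar> ^ Suc k / fact (Suc k) * 0"
    by (intro tendsto_mult tendsto_const
        tendsto_divide_0[OF tendsto_mult[OF tendsto_const lim] filterlim_at_top_imp_at_infinity[OF l_top]])
  then show "(\<lambda>n. \<bar>z\<bar> ^ Suc k / fact (Suc k) * ((k - \<beta>) * ts_moment k (\<alpha> n) \<beta> (l n) / l n)) \<longlonglongrightarrow> 0"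
    by simp
qed

lemma ts_exponent_0: "ts_exponent 0 \<beta> l z = 0"
  by (simp add: ts_exponent_def ts_levy_density_def)

text \<open>The limit \<open>\<alpha> = 0\<close>, with exponent 0, is admitted, which covers the degenerate limit laws.\<close>

lemma ts_exponent_tendsto:
  assumes \<alpha>s: "\<And>n. \<alpha>s n \<ge> 0"
    and lim: "\<alpha>s \<longlonglongrightarrow> \<alpha>" "\<beta>s \<longlonglongrightarrow> \<beta>" "ls \<longlonglongrightarrow> l"
    and \<beta>: "\<And>n. \<beta>s n \<ge> 0" "\<beta> < 1" and l: "l > 0"
  shows "(\<lambda>n. ts_exponent (\<alpha>s n) (\<beta>s n) (ls n) z) \<longlonglongrightarrow> ts_exponent \<alpha> \<beta> l z"
proof -
  \<comment> \<open>A midpoint between \<beta> and 1: eventually all \<beta>s stay below b, while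
    x^(-b) is still integrable at 0.\<close>
  define b where "b = (1 + \<beta>) / 2"
  have b: "\<beta> < b" "b < 1" using \<beta> by (auto simp: b_def)
  have "\<forall>\<^sub>F n in sequentially. \<alpha>s n < \<alpha> + 1" "\<forall>\<^sub>F n in sequentially. \<beta>s n < b"
    "\<forall>\<^sub>F n in sequentially. l / 2 < ls n"
    using order_tendstoD(2)[OF lim(1), of "\<alpha> + 1"] order_tendstoD(2)[OF lim(2) b(1)]
      order_tendstoD(1)[OF lim(3), of "l / 2"] l by simp_all
  then have "\<forall>\<^sub>F n in sequentially. \<alpha>s n \<le> \<alpha> + 1 \<and> \<beta>s n \<le> b \<and> l / 2 \<le> ls n"
    by eventually_elim auto
  then obtain n0 where n0: "\<And>n. n \<ge> n0 \<Longrightarrow> \<alpha>s n \<le> \<alpha> + 1 \<and> \<beta>s n \<le> b \<and> l / 2 \<le> ls n"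
    by (auto simp: eventually_sequentially)
  \<comment> \<open>The bound |z| x on |e^(izx) - 1| leaves x^(-\<beta>s n), which is at most 1 +
    x^(-b). The two exponents are spelled out to match Gamma integrals with s = 1 and s = 1 -
    b.\<close>
  define w where "w x = (\<alpha> + 1) * \<bar>z\<bar> * (x powr (1 - 1) * exp (- (l / 2) * x) * indicator {0<..} x
      + x powr ((1 - b) - 1) * exp (- (l / 2) * x) * indicator {0<..} x)" for x :: real
  have int_w: "integrable lborel w"
    unfolding w_def
    by (intro integrable_mult_right Bochner_Integration.integrable_add
        integrable.intros[OF has_bochner_integral_Gamma_scaled]) (use b l in auto)
  \<comment> \<open>The bound w is valid only from index n0 on, whereas dominated convergence asks
    for it at every index; hence the shift.\<close>
  have "(\<lambda>n. ts_exponent (\<alpha>s (n + n0)) (\<beta>s (n + n0)) (ls (n + n0)) z) \<longlonglongrightarrow> ts_exponent \<alpha> \<beta> l z"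
    unfolding ts_exponent_def
  proof (rule integral_dominated_convergence[OF _ _ int_w])
    show "AE x in lborel. (\<lambda>n. complex_of_real (ts_levy_density (\<alpha>s (n + n0)) (\<beta>s (n + n0)) (ls (n + n0)) x) * (iexp (z * x) - 1))
        \<longlonglongrightarrow> complex_of_real (ts_levy_density \<alpha> \<beta> l x) * (iexp (z * x) - 1)"
      unfolding ts_levy_density_def
      by (intro AE_I2) (auto intro!: tendsto_intros LIMSEQ_ignore_initial_segment lim split: split_indicator)
    fix n
    let ?a = "\<alpha>s (n + n0)" and ?b = "\<beta>s (n + n0)" and ?l = "ls (n + n0)"
    have par: "?a \<le> \<alpha> + 1" "?b \<le> b" "l / 2 \<le> ?l" using n0[of "n + n0"] by auto
    show "AE x in lborel. norm (complex_of_real (ts_levy_density ?a ?b ?l x) * (iexp (z * x) - 1)) \<le> w x"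
    proof (rule AE_I2)
      fix x :: real
      show "norm (complex_of_real (ts_levy_density ?a ?b ?l x) * (iexp (z * x) - 1)) \<le> w x"
      proof (cases "x > 0")
        case x: True
        have "x powr (- ?b) \<le> 1 + x powr (- b)"
        proof (cases "x \<ge> 1")
          case True
          then have "x powr (- ?b) \<le> x powr 0"
            using \<beta>(1)[of "n + n0"] by (intro powr_mono) auto
          then show ?thesis using x by (simp add: add_increasing2)
        next
          case False
          then have "x powr (- ?b) \<le> x powr (- b)"
            using x par by (intro powr_mono') auto
          then show ?thesis by simp
        qed
        then have 1: "?a * (x powr (- ?b) * exp (- ?l * x)) \<le> (\<alpha> + 1) * ((1 + x powr (- b)) * exp (- (l / 2) * x))"
          using x par \<alpha>s[of "n + n0"] by (intro mult_mono) auto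
        have "norm (complex_of_real (ts_levy_density ?a ?b ?l x) * (iexp (z * x) - 1))
            \<le> ts_levy_density ?a ?b ?l x * \<bar>z * x\<bar>"
          using norm_iexp_minus_1_le[of "z * x"] ts_levy_density_nonneg[OF \<alpha>s, of "n + n0" ?b ?l x]
          by (auto simp: norm_mult intro!: mult_left_mono)
        also have "\<dots> = \<bar>z\<bar> * (?a * (x powr (- ?b) * exp (- ?l * x)))"
          using x by (simp add: ts_levy_density_def abs_mult powr_add powr_minus field_simps)
        also have "\<dots> \<le> \<bar>z\<bar> * ((\<alpha> + 1) * ((1 + x powr (- b)) * exp (- (l / 2) * x)))"
          by (intro mult_left_mono 1) auto
        also have "\<dots> = w x"
          using x by (simp add: w_def algebra_simps)
        finally show ?thesis .
      qed (simp add: ts_levy_density_def w_def)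
    qed
  qed measurable
  then show ?thesis by (rule LIMSEQ_offset)
qed

section \<open>Characteristic functions of the limit laws and the continuity theorem\<close>

lemma char_normal_distribution:
  assumes "\<sigma> > 0"
  shows "char (density lborel (normal_density \<mu> \<sigma>)) z = exp (\<i> * z * \<mu> - z\<^sup>2 * \<sigma>\<^sup>2 / 2)"
proof -
  interpret N: real_distribution std_normal_distribution
    by (rule real_dist_normal_dist)
  have "distributed std_normal_distribution lborel (\<lambda>x. x) std_normal_density"
    by (auto simp: distributed_def intro!: distr_id2)
  \<comment> \<open>The normal law is the image of the standard one under x -> \<mu> + \<sigma> x,
    which reduces its characteristic function at z to the standard one at z \<sigma>.\<close>
  from N.normal_density_affine[OF this, of \<sigma> \<mu>]
  have "density lborel (normal_density \<mu> \<sigma>) = distr std_normal_distribution lborel (\<lambda>x. \<mu> + \<sigma> * x)"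
    using assms by (simp add: distributed_def)
  then have "char (density lborel (normal_density \<mu> \<sigma>)) z
      = (CLINT x|std_normal_distribution. iexp (z * \<mu>) * iexp ((z * \<sigma>) * x))"
    unfolding char_def
    by (subst \<open>density lborel (normal_density \<mu> \<sigma>) = _\<close>, subst integral_distr)
      (auto simp: algebra_simps simp flip: exp_add intro!: Bochner_Integration.integral_cong)
  also have "\<dots> = iexp (z * \<mu>) * char std_normal_distribution (z * \<sigma>)"
    by (simp add: char_def)
  also have "\<dots> = exp (\<i> * complex_of_real (z * \<mu>) + complex_of_real (- ((z * \<sigma>)\<^sup>2) / 2))"
    by (simp only: char_std_normal_distribution exp_add exp_of_real)
  also have "\<i> * complex_of_real (z * \<mu>) + complex_of_real (- ((z * \<sigma>)\<^sup>2) / 2)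
      = \<i> * z * \<mu> - z\<^sup>2 * \<sigma>\<^sup>2 / 2"
    by (simp add: power_mult_distrib)
  finally show ?thesis .
qed

lemma real_distribution_return: "real_distribution (return borel c)"
  by (auto simp: real_distribution_def real_distribution_axioms_def intro: prob_space_return)

lemma char_return: "char (return borel c) z = iexp (z * c)"
  unfolding char_def by (subst integral_return) auto

text \<open>Levy's continuity theorem at the level of exponents: continuity of exp passes from the
  exponents to the characteristic functions, so no complex logarithm is involved.\<close>

lemma weak_conv_TSI:
  assumes "\<And>n. (\<alpha>p n, \<beta>p n, lp n) \<in> ts_parameters" "\<And>n. (\<alpha>m n, \<beta>m n, lm n) \<in> ts_parameters"
    and M: "real_distribution M" "\<And>z. char M z = exp (\<Psi> z)"
    and lim: "\<And>z. (\<lambda>n. ts_exponent (\<alpha>p n) (\<beta>p n) (lp n) z + ts_exponent (\<alpha>m n) (\<beta>m n) (lm n) (- z)) \<longlonglongrightarrow> \<Psi> z"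
  shows "weak_conv_m (\<lambda>n. TS (\<alpha>p n) (\<beta>p n) (lp n) (\<alpha>m n) (\<beta>m n) (lm n)) M"
  using assms
  by (intro levy_continuity) (auto simp: real_distribution_TS char_TS intro!: tendsto_exp)

lemma tendsto_Pair_iff:
  "((\<lambda>x. (f x, g x)) \<longlongrightarrow> (a, b)) F \<longleftrightarrow> (f \<longlongrightarrow> a) F \<and> (g \<longlongrightarrow> b) F"
  using tendsto_fst[of "\<lambda>x. (f x, g x)" "(a, b)" F] tendsto_snd[of "\<lambda>x. (f x, g x)" "(a, b)" F]
  by (auto intro: tendsto_Pair)

section \<open>Passage to the limit in the five parameter regimes\<close>

theorem proposition3p1:
  fixes \<alpha>p\<^sub>n \<beta>p\<^sub>n lp\<^sub>n \<alpha>m\<^sub>n \<beta>m\<^sub>n lm\<^sub>n :: "nat \<Rightarrow> real"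
    and \<alpha>p \<beta>p lp \<alpha>m \<beta>m lm :: real
  assumes "\<And>n. (\<alpha>p\<^sub>n n, \<beta>p\<^sub>n n, lp\<^sub>n n) \<in> ts_parameters"
    and "\<And>n. (\<alpha>m\<^sub>n n, \<beta>m\<^sub>n n, lm\<^sub>n n) \<in> ts_parameters"
    and "(\<alpha>p, \<beta>p, lp) \<in> ts_parameters"
    and "(\<alpha>m, \<beta>m, lm) \<in> ts_parameters"
  shows
    "((\<lambda>n. (\<alpha>p\<^sub>n n, \<beta>p\<^sub>n n, lp\<^sub>n n, \<alpha>m\<^sub>n n, \<beta>m\<^sub>n n, lm\<^sub>n n)) \<longlonglongrightarrow> (\<alpha>p, \<beta>p, lp, \<alpha>m, \<beta>m, lm) \<longrightarrow>
        weak_conv_m (\<lambda>n. TS (\<alpha>p\<^sub>n n) (\<beta>p\<^sub>n n) (lp\<^sub>n n) (\<alpha>m\<^sub>n n) (\<beta>m\<^sub>n n) (lm\<^sub>n n))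
          (TS \<alpha>p \<beta>p lp \<alpha>m \<beta>m lm))
   \<and> (\<alpha>m\<^sub>n \<longlonglongrightarrow> 0 \<and>
        (\<lambda>n. (\<alpha>p\<^sub>n n, \<beta>p\<^sub>n n, lp\<^sub>n n, \<beta>m\<^sub>n n, lm\<^sub>n n)) \<longlonglongrightarrow> (\<alpha>p, \<beta>p, lp, \<beta>m, lm) \<longrightarrow>
        weak_conv_m (\<lambda>n. TS (\<alpha>p\<^sub>n n) (\<beta>p\<^sub>n n) (lp\<^sub>n n) (\<alpha>m\<^sub>n n) (\<beta>m\<^sub>n n) (lm\<^sub>n n))
          (one_sided_TS \<alpha>p \<beta>p lp))
   \<and> (\<alpha>p\<^sub>n \<longlonglongrightarrow> 0 \<and> \<alpha>m\<^sub>n \<longlonglongrightarrow> 0 \<and>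
        (\<lambda>n. (\<beta>p\<^sub>n n, lp\<^sub>n n, \<beta>m\<^sub>n n, lm\<^sub>n n)) \<longlonglongrightarrow> (\<beta>p, lp, \<beta>m, lm) \<longrightarrow>
        weak_conv_m (\<lambda>n. TS (\<alpha>p\<^sub>n n) (\<beta>p\<^sub>n n) (lp\<^sub>n n) (\<alpha>m\<^sub>n n) (\<beta>m\<^sub>n n) (lm\<^sub>n n))
          (return borel 0))
   \<and> (\<forall>\<mu>p\<ge>0. \<forall>\<mu>m\<ge>0.
        filterlim \<alpha>p\<^sub>n at_top sequentially \<and> filterlim \<alpha>m\<^sub>n at_top sequentially \<and>
        filterlim lp\<^sub>n at_top sequentially \<and> filterlim lm\<^sub>n at_top sequentially \<and>
        (\<lambda>n. Gamma (1 - \<beta>p) * (\<alpha>p\<^sub>n n / lp\<^sub>n n powr (1 - \<beta>p))) \<longlonglongrightarrow> \<mu>p \<and>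
        (\<lambda>n. Gamma (1 - \<beta>m) * (\<alpha>m\<^sub>n n / lm\<^sub>n n powr (1 - \<beta>m))) \<longlonglongrightarrow> \<mu>m \<longrightarrow>
        weak_conv_m (\<lambda>n. TS (\<alpha>p\<^sub>n n) \<beta>p (lp\<^sub>n n) (\<alpha>m\<^sub>n n) \<beta>m (lm\<^sub>n n))
          (return borel (\<mu>p - \<mu>m)))
   \<and> (\<forall>\<mu> \<sigma>p \<sigma>m.
        \<sigma>p^2 > 0 \<and> \<sigma>m^2 > 0 \<and>
        filterlim \<alpha>p\<^sub>n at_top sequentially \<and> filterlim \<alpha>m\<^sub>n at_top sequentially \<and>
        filterlim lp\<^sub>n at_top sequentially \<and> filterlim lm\<^sub>n at_top sequentially \<and>
        (\<lambda>n. Gamma (1 - \<beta>p) * (\<alpha>p\<^sub>n n / lp\<^sub>n n powr (1 - \<beta>p))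
            - Gamma (1 - \<beta>m) * (\<alpha>m\<^sub>n n / lm\<^sub>n n powr (1 - \<beta>m))) \<longlonglongrightarrow> \<mu> \<and>
        (\<lambda>n. Gamma (2 - \<beta>p) * (\<alpha>p\<^sub>n n / lp\<^sub>n n powr (2 - \<beta>p))) \<longlonglongrightarrow> \<sigma>p^2 \<and>
        (\<lambda>n. Gamma (2 - \<beta>m) * (\<alpha>m\<^sub>n n / lm\<^sub>n n powr (2 - \<beta>m))) \<longlonglongrightarrow> \<sigma>m^2 \<longrightarrow>
        weak_conv_m (\<lambda>n. TS (\<alpha>p\<^sub>n n) \<beta>p (lp\<^sub>n n) (\<alpha>m\<^sub>n n) \<beta>m (lm\<^sub>n n))
          (density lborel (normal_density \<mu> (sqrt (\<sigma>p^2 + \<sigma>m^2)))))"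
proof (intro conjI impI allI)
  note p = assms(1)
  note m = assms(2)
  have p_bounds: "0 < \<alpha>p\<^sub>n n" "0 \<le> \<beta>p\<^sub>n n" "0 < lp\<^sub>n n"
    and m_bounds: "0 < \<alpha>m\<^sub>n n" "0 \<le> \<beta>m\<^sub>n n" "0 < lm\<^sub>n n" for n
    using p[of n] m[of n] by (auto simp: ts_parameters_def)
  have bounds: "0 \<le> \<beta>p" "\<beta>p < 1" "0 < lp" "0 \<le> \<beta>m" "\<beta>m < 1" "0 < lm"
    using assms(3,4) by (auto simp: ts_parameters_def)
  \<comment> \<open>The limit of the \<alpha> parameters is left open, since statements (1) to (3)
    use both positive limits and 0.\<close>
  note pn = ts_exponent_tendsto[of \<alpha>p\<^sub>n _ \<beta>p\<^sub>n \<beta>p lp\<^sub>n lp, OF less_imp_le[OF p_bounds(1)] _ _ _ p_bounds(2) bounds(2,3)]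
  note mn = ts_exponent_tendsto[of \<alpha>m\<^sub>n _ \<beta>m\<^sub>n \<beta>m lm\<^sub>n lm, OF less_imp_le[OF m_bounds(1)] _ _ _ m_bounds(2) bounds(5,6)]
  show "weak_conv_m (\<lambda>n. TS (\<alpha>p\<^sub>n n) (\<beta>p\<^sub>n n) (lp\<^sub>n n) (\<alpha>m\<^sub>n n) (\<beta>m\<^sub>n n) (lm\<^sub>n n)) (TS \<alpha>p \<beta>p lp \<alpha>m \<beta>m lm)"
    if "(\<lambda>n. (\<alpha>p\<^sub>n n, \<beta>p\<^sub>n n, lp\<^sub>n n, \<alpha>m\<^sub>n n, \<beta>m\<^sub>n n, lm\<^sub>n n)) \<longlonglongrightarrow> (\<alpha>p, \<beta>p, lp, \<alpha>m, \<beta>m, lm)"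
  proof -
    have "\<alpha>p\<^sub>n \<longlonglongrightarrow> \<alpha>p" "\<beta>p\<^sub>n \<longlonglongrightarrow> \<beta>p" "lp\<^sub>n \<longlonglongrightarrow> lp" "\<alpha>m\<^sub>n \<longlonglongrightarrow> \<alpha>m" "\<beta>m\<^sub>n \<longlonglongrightarrow> \<beta>m" "lm\<^sub>n \<longlonglongrightarrow> lm"
      using that by (simp_all add: tendsto_Pair_iff)
    then show ?thesis
      using assms(3,4) by (intro weak_conv_TSI[OF p m _ char_TS] tendsto_add pn mn real_distribution_TS)
  qed
  show "weak_conv_m (\<lambda>n. TS (\<alpha>p\<^sub>n n) (\<beta>p\<^sub>n n) (lp\<^sub>n n) (\<alpha>m\<^sub>n n) (\<beta>m\<^sub>n n) (lm\<^sub>n n)) (one_sided_TS \<alpha>p \<beta>p lp)"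
    if "\<alpha>m\<^sub>n \<longlonglongrightarrow> 0 \<and> (\<lambda>n. (\<alpha>p\<^sub>n n, \<beta>p\<^sub>n n, lp\<^sub>n n, \<beta>m\<^sub>n n, lm\<^sub>n n)) \<longlonglongrightarrow> (\<alpha>p, \<beta>p, lp, \<beta>m, lm)"
  proof -
    have lims: "\<alpha>p\<^sub>n \<longlonglongrightarrow> \<alpha>p" "\<beta>p\<^sub>n \<longlonglongrightarrow> \<beta>p" "lp\<^sub>n \<longlonglongrightarrow> lp" "\<alpha>m\<^sub>n \<longlonglongrightarrow> 0" "\<beta>m\<^sub>n \<longlonglongrightarrow> \<beta>m" "lm\<^sub>n \<longlonglongrightarrow> lm"
      using that by (simp_all add: tendsto_Pair_iff)
    have "(\<lambda>n. ts_exponent (\<alpha>p\<^sub>n n) (\<beta>p\<^sub>n n) (lp\<^sub>n n) z + ts_exponent (\<alpha>m\<^sub>n n) (\<beta>m\<^sub>n n) (lm\<^sub>n n) (- z))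
        \<longlonglongrightarrow> ts_exponent \<alpha>p \<beta>p lp z" for z
      using tendsto_add[OF pn[of _ z, OF lims(1-3)] mn[of _ "- z", OF lims(4-6)]] by (simp add: ts_exponent_0)
    then show ?thesis
      using assms(3) by (intro weak_conv_TSI[OF p m _ char_one_sided_TS] real_distribution_one_sided_TS)
  qed
  show "weak_conv_m (\<lambda>n. TS (\<alpha>p\<^sub>n n) (\<beta>p\<^sub>n n) (lp\<^sub>n n) (\<alpha>m\<^sub>n n) (\<beta>m\<^sub>n n) (lm\<^sub>n n)) (return borel 0)"
    if "\<alpha>p\<^sub>n \<longlonglongrightarrow> 0 \<and> \<alpha>m\<^sub>n \<longlonglongrightarrow> 0 \<and> (\<lambda>n. (\<beta>p\<^sub>n n, lp\<^sub>n n, \<beta>m\<^sub>n n, lm\<^sub>n n)) \<longlonglongrightarrow> (\<beta>p, lp, \<beta>m, lm)"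
  proof -
    have lims: "\<alpha>p\<^sub>n \<longlonglongrightarrow> 0" "\<beta>p\<^sub>n \<longlonglongrightarrow> \<beta>p" "lp\<^sub>n \<longlonglongrightarrow> lp" "\<alpha>m\<^sub>n \<longlonglongrightarrow> 0" "\<beta>m\<^sub>n \<longlonglongrightarrow> \<beta>m" "lm\<^sub>n \<longlonglongrightarrow> lm"
      using that by (simp_all add: tendsto_Pair_iff)
    \<comment> \<open>The limit 0 is written as i (z * 0) to match the exponent of the point mass at
      0 in \<open>char_return\<close>.\<close>
    have "(\<lambda>n. ts_exponent (\<alpha>p\<^sub>n n) (\<beta>p\<^sub>n n) (lp\<^sub>n n) z + ts_exponent (\<alpha>m\<^sub>n n) (\<beta>m\<^sub>n n) (lm\<^sub>n n) (- z))
        \<longlonglongrightarrow> \<i> * complex_of_real (z * 0)" for z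
      using tendsto_add[OF pn[of _ z, OF lims(1-3)] mn[of _ "- z", OF lims(4-6)]] by (simp add: ts_exponent_0)
    then show ?thesis
      by (rule weak_conv_TSI[OF p m real_distribution_return char_return])
  qed

  \<comment> \<open>Parts 4 and 5: expand both exponents to the order at which the moments converge; the
    remainder is bounded by the next moment, which carries an additional factor \<open>1 / l\<close>.\<close>
  have p': "(\<alpha>p\<^sub>n n, \<beta>p, lp\<^sub>n n) \<in> ts_parameters" and m': "(\<alpha>m\<^sub>n n, \<beta>m, lm\<^sub>n n) \<in> ts_parameters" for n
    using p_bounds[of n] m_bounds[of n] bounds by (auto simp: ts_parameters_def)
  note p_rem = ts_exponent_remainder_tendsto_0[of _ \<beta>p \<alpha>p\<^sub>n lp\<^sub>n, OF _ bounds(2) less_imp_le[OF p_bounds(1)] p_bounds(3)]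
  note m_rem = ts_exponent_remainder_tendsto_0[of _ \<beta>m \<alpha>m\<^sub>n lm\<^sub>n, OF _ bounds(5) less_imp_le[OF m_bounds(1)] m_bounds(3)]
  show "weak_conv_m (\<lambda>n. TS (\<alpha>p\<^sub>n n) \<beta>p (lp\<^sub>n n) (\<alpha>m\<^sub>n n) \<beta>m (lm\<^sub>n n)) (return borel (\<mu>p - \<mu>m))"
    if "filterlim \<alpha>p\<^sub>n at_top sequentially \<and> filterlim \<alpha>m\<^sub>n at_top sequentially \<and>
        filterlim lp\<^sub>n at_top sequentially \<and> filterlim lm\<^sub>n at_top sequentially \<and>
        (\<lambda>n. Gamma (1 - \<beta>p) * (\<alpha>p\<^sub>n n / lp\<^sub>n n powr (1 - \<beta>p))) \<longlonglongrightarrow> \<mu>p \<and>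
        (\<lambda>n. Gamma (1 - \<beta>m) * (\<alpha>m\<^sub>n n / lm\<^sub>n n powr (1 - \<beta>m))) \<longlonglongrightarrow> \<mu>m" for \<mu>p \<mu>m
  proof (rule weak_conv_TSI[OF p' m' real_distribution_return char_return])
    fix z
    have top: "filterlim lp\<^sub>n at_top sequentially" "filterlim lm\<^sub>n at_top sequentially"
      and mom: "(\<lambda>n. ts_moment 1 (\<alpha>p\<^sub>n n) \<beta>p (lp\<^sub>n n)) \<longlonglongrightarrow> \<mu>p" "(\<lambda>n. ts_moment 1 (\<alpha>m\<^sub>n n) \<beta>m (lm\<^sub>n n)) \<longlonglongrightarrow> \<mu>m"
      using that by (simp_all add: ts_moment_def)
    \<comment> \<open>Two first-order remainders plus the drift terms; evaluating the negative part
      at \<open>- z\<close> gives \<open>\<mu>m\<close> its minus sign.\<close>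
    have "(\<lambda>n. (ts_exponent (\<alpha>p\<^sub>n n) \<beta>p (lp\<^sub>n n) z - \<i> * z * ts_moment 1 (\<alpha>p\<^sub>n n) \<beta>p (lp\<^sub>n n))
        + (ts_exponent (\<alpha>m\<^sub>n n) \<beta>m (lm\<^sub>n n) (- z) - \<i> * (- z) * ts_moment 1 (\<alpha>m\<^sub>n n) \<beta>m (lm\<^sub>n n))
        + (\<i> * z * ts_moment 1 (\<alpha>p\<^sub>n n) \<beta>p (lp\<^sub>n n) + \<i> * (- z) * ts_moment 1 (\<alpha>m\<^sub>n n) \<beta>m (lm\<^sub>n n)))
        \<longlonglongrightarrow> 0 + 0 + (\<i> * z * \<mu>p + \<i> * (- z) * \<mu>m)"
      using p_rem[OF _ top(1) mom(1), of z] m_rem[OF _ top(2) mom(2), of "- z"]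
      by (intro tendsto_add tendsto_mult tendsto_const tendsto_of_real mom) simp_all
    then show "(\<lambda>n. ts_exponent (\<alpha>p\<^sub>n n) \<beta>p (lp\<^sub>n n) z + ts_exponent (\<alpha>m\<^sub>n n) \<beta>m (lm\<^sub>n n) (- z))
        \<longlonglongrightarrow> \<i> * complex_of_real (z * (\<mu>p - \<mu>m))"
      by (simp add: algebra_simps)
  qed
  show "weak_conv_m (\<lambda>n. TS (\<alpha>p\<^sub>n n) \<beta>p (lp\<^sub>n n) (\<alpha>m\<^sub>n n) \<beta>m (lm\<^sub>n n))
      (density lborel (normal_density \<mu> (sqrt (\<sigma>p\<^sup>2 + \<sigma>m\<^sup>2))))"
    if H: "\<sigma>p^2 > 0 \<and> \<sigma>m^2 > 0 \<and>
        filterlim \<alpha>p\<^sub>n at_top sequentially \<and> filterlim \<alpha>m\<^sub>n at_top sequentially \<and>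
        filterlim lp\<^sub>n at_top sequentially \<and> filterlim lm\<^sub>n at_top sequentially \<and>
        (\<lambda>n. Gamma (1 - \<beta>p) * (\<alpha>p\<^sub>n n / lp\<^sub>n n powr (1 - \<beta>p))
            - Gamma (1 - \<beta>m) * (\<alpha>m\<^sub>n n / lm\<^sub>n n powr (1 - \<beta>m))) \<longlonglongrightarrow> \<mu> \<and>
        (\<lambda>n. Gamma (2 - \<beta>p) * (\<alpha>p\<^sub>n n / lp\<^sub>n n powr (2 - \<beta>p))) \<longlonglongrightarrow> \<sigma>p^2 \<and>
        (\<lambda>n. Gamma (2 - \<beta>m) * (\<alpha>m\<^sub>n n / lm\<^sub>n n powr (2 - \<beta>m))) \<longlonglongrightarrow> \<sigma>m^2" for \<mu> \<sigma>p \<sigma>m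
  proof -
    let ?\<sigma> = "sqrt (\<sigma>p\<^sup>2 + \<sigma>m\<^sup>2)"
    have \<sigma>: "?\<sigma> > 0" using H by (simp add: add_pos_pos)
    have rd: "real_distribution (density lborel (normal_density \<mu> ?\<sigma>))"
      using prob_space_normal_density[OF \<sigma>] by (simp add: real_distribution_def real_distribution_axioms_def)
    let ?m = "\<lambda>k n. ts_moment k (\<alpha>p\<^sub>n n) \<beta>p (lp\<^sub>n n)" and ?m' = "\<lambda>k n. ts_moment k (\<alpha>m\<^sub>n n) \<beta>m (lm\<^sub>n n)"
    have top: "filterlim lp\<^sub>n at_top sequentially" "filterlim lm\<^sub>n at_top sequentially"
      and mom: "(\<lambda>n. ?m 1 n - ?m' 1 n) \<longlonglongrightarrow> \<mu>" "?m 2 \<longlonglongrightarrow> \<sigma>p\<^sup>2" "?m' 2 \<longlonglongrightarrow> \<sigma>m\<^sup>2"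
      using H by (simp_all add: ts_moment_def)
    \<comment> \<open>The second-order polynomial in closed form, with i^2 = -1; \<open>c\<close> is
      generic so that it covers the moments of both parts.\<close>
    have two: "(\<Sum>j=1..2. (\<i> * complex_of_real w) ^ j / fact j * c j) = \<i> * w * c 1 - w\<^sup>2 * c 2 / 2"
      for w and c :: "nat \<Rightarrow> complex"
      by (simp add: numeral_2_eq_2 power_mult_distrib)
    show ?thesis
    proof (rule weak_conv_TSI[OF p' m' rd char_normal_distribution[OF \<sigma>]])
      fix z
      \<comment> \<open>The first moments are grouped as a difference because each one alone tends
        to infinity, being the second moment times l / (1 - \<beta>). The second moments add up, as
        the square of \<open>- z\<close> removes the sign.\<close>
      have "(\<lambda>n. (ts_exponent (\<alpha>p\<^sub>n n) \<beta>p (lp\<^sub>n n) z - (\<i> * z * ?m 1 n - z\<^sup>2 * ?m 2 n / 2))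
          + (ts_exponent (\<alpha>m\<^sub>n n) \<beta>m (lm\<^sub>n n) (- z) - (\<i> * complex_of_real (- z) * ?m' 1 n - (complex_of_real (- z))\<^sup>2 * ?m' 2 n / 2))
          + (\<i> * z * complex_of_real (?m 1 n - ?m' 1 n) - complex_of_real (z\<^sup>2) * complex_of_real (?m 2 n + ?m' 2 n) / 2))
          \<longlonglongrightarrow> 0 + 0 + (\<i> * z * complex_of_real \<mu> - complex_of_real (z\<^sup>2) * complex_of_real (\<sigma>p\<^sup>2 + \<sigma>m\<^sup>2) / 2)"
        using p_rem[OF one_le_numeral top(1) mom(2), of z, unfolded two]
          m_rem[OF one_le_numeral top(2) mom(3), of "- z", unfolded two]
        by (intro tendsto_add tendsto_diff tendsto_mult tendsto_divide tendsto_const tendsto_of_real mom) simp_all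
      then show "(\<lambda>n. ts_exponent (\<alpha>p\<^sub>n n) \<beta>p (lp\<^sub>n n) z + ts_exponent (\<alpha>m\<^sub>n n) \<beta>m (lm\<^sub>n n) (- z))
          \<longlonglongrightarrow> \<i> * z * \<mu> - z\<^sup>2 * ?\<sigma>\<^sup>2 / 2"
        by (simp add: algebra_simps diff_divide_distrib add_divide_distrib)
    qed
  qed
qed

end
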